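(* Let $G$ be a connected finite graph and let $H$ be a graph such that $|V(G)|=|V(H)|$ and $|E(G)|=|E(H)|$. Then $h_H(G)=|E(H)|$ if and only if $H$ is isomorphic to the graph $G$.
   Context: All graphs are finite, simple and undirected. For a connected graph $G$, $\rho_G(x,y)$ denotes the graph distance of vertices $x,y$ in $G$. Given graphs $G,H$ with $|V(G)|=|V(H)|$, a pseudoordering on $G$ by $H$ is a bijection $f:V(H)\to V(G)$, and its sum is $$s_H(f,G)=\sum_{\{x,y\}\in E(H)}\rho_G(f(x),f(y)).$$ The lower $H$-Hamiltonian number of $G$ is $h_H(G)=\min\{s_H(f,G)\mid f \text{ a pseudoordering on } G \text{ by } H\}$. *)

theory Defs
  imports "Graph_Theory.Graph_Theory"
begin

text \<open>
  A finite simple undirected graph is an instance of the locale \<^locale>\<open>graph\<close>: a finite, loop-free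
  digraph without parallel arcs whose arc relation is symmetric. Each undirected edge
  \<open>{x, y}\<close> is represented by the two arcs from \<open>x\<close> to \<open>y\<close> and from \<open>y\<close> to \<open>x\<close>, so edges have to be
  counted, and summed over, as unordered pairs and not as arcs.
\<close>

definition edges :: "('a, 'b) pre_digraph \<Rightarrow> 'a set set" where
  "edges G = {{x, y} | x y. x \<rightarrow>\<^bsub>G\<^esub> y}"

text \<open>The value is meaningful only if \<open>y\<close> is reachable from \<open>x\<close>, e.g. if \<open>G\<close> is connected;
  it then agrees with the library's \<^const>\<open>wf_digraph.\<mu>\<close> for unit weights (lemma
  \<open>\<mu>_unit_eq_graph_dist\<close> below).\<close>

definition graph_dist :: "('a, 'b) pre_digraph \<Rightarrow> 'a \<Rightarrow> 'a \<Rightarrow> nat" where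
  "graph_dist G x y = (LEAST n. \<exists>p. pre_digraph.awalk G x p y \<and> length p = n)"

definition pseudoordering ::
    "('a, 'b) pre_digraph \<Rightarrow> ('c, 'd) pre_digraph \<Rightarrow> ('c \<Rightarrow> 'a) \<Rightarrow> bool" where
  "pseudoordering G H f \<longleftrightarrow> bij_betw f (verts H) (verts G)"

text \<open>The description operator picks the summand \<open>\<rho>\<^sub>G(f(x), f(y))\<close> of the edge \<open>e = {x, y}\<close>; it is
  independent of the order of \<open>x\<close> and \<open>y\<close> because the distance is symmetric (lemma
  \<open>edge_summand\<close> below).\<close>

definition pseudo_sum ::
    "('a, 'b) pre_digraph \<Rightarrow> ('c, 'd) pre_digraph \<Rightarrow> ('c \<Rightarrow> 'a) \<Rightarrow> nat" where
  "pseudo_sum G H f =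
    (\<Sum>e\<in>edges H. THE d. \<exists>x y. e = {x, y} \<and> d = graph_dist G (f x) (f y))"

text \<open>The minimum is over a finite nonempty set whenever \<open>G\<close> and \<open>H\<close> are finite with equally many
  vertices (lemma \<open>pseudo_sums_finite_nonempty\<close> below).\<close>

definition lower_hamiltonian_number ::
    "('a, 'b) pre_digraph \<Rightarrow> ('c, 'd) pre_digraph \<Rightarrow> nat" where
  "lower_hamiltonian_number G H = Min {pseudo_sum G H f | f. pseudoordering G H f}"

lemma (in wf_digraph) \<mu>_unit_eq_graph_dist:
  assumes "x \<rightarrow>\<^sup>*\<^bsub>G\<^esub> y"
  shows "\<mu> (\<lambda>_. 1) x y = ereal (real (graph_dist G x y))"
proof -
  have cost: "awalk_cost (\<lambda>_. 1) p = real (length p)" for p :: "'b list"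
    by (induct p) auto
  from assms obtain p where p: "awalk x p y"
    by (auto simp: reachable_awalk)
  let ?P = "\<lambda>n. \<exists>p. awalk x p y \<and> length p = n"
  have "?P (graph_dist G x y)"
    unfolding graph_dist_def by (rule LeastI[of ?P "length p"]) (use p in blast)
  then obtain q where q: "awalk x q y" "length q = graph_dist G x y" by blast
  have least: "graph_dist G x y \<le> length r" if "awalk x r y" for r
    unfolding graph_dist_def by (rule Least_le) (use that in blast)
  show ?thesis
    unfolding \<mu>_def cost
  proof (rule antisym)
    show "(INF p\<in>{p. awalk x p y}. ereal (real (length p))) \<le> ereal (real (graph_dist G x y))"
      by (rule INF_lower2[of q]) (use q in auto)
    show "ereal (real (graph_dist G x y)) \<le> (INF p\<in>{p. awalk x p y}. ereal (real (length p)))"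
      by (rule INF_greatest) (use least in auto)
  qed
qed

lemma (in sym_digraph) awalk_reverse_length:
  assumes "awalk x p y"
  shows "\<exists>q. awalk y q x \<and> length q = length p"
  using assms
proof (induct p arbitrary: x)
  case Nil
  then show ?case by (intro exI[of _ "[]"]) (auto simp: awalk_Nil_iff)
next
  case (Cons e p)
  then have e: "e \<in> arcs G" "x = tail G e" and w: "awalk (head G e) p y"
    by (auto simp: awalk_Cons_iff)
  from Cons(1)[OF w] obtain q where q: "awalk y q (head G e)" "length q = length p" by blast
  from sym_arcs e obtain e' where e': "e' \<in> arcs G" "tail G e' = head G e" "head G e' = x"
    by (force simp: symmetric_conv)
  then have "awalk (head G e) [e'] x"
    by (auto simp: awalk_Cons_iff awalk_Nil_iff)
  with q have "awalk y (q @ [e']) x" by (auto intro: awalk_appendI)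
  with q show ?case by (intro exI[of _ "q @ [e']"]) auto
qed

lemma (in sym_digraph) graph_dist_commute: "graph_dist G x y = graph_dist G y x"
proof -
  have "(\<exists>p. awalk x p y \<and> length p = n) \<longleftrightarrow> (\<exists>p. awalk y p x \<and> length p = n)" for n
    using awalk_reverse_length by metis
  then show ?thesis unfolding graph_dist_def by simp
qed

lemma (in sym_digraph) edge_summand:
  "(THE d. \<exists>x' y'. {x, y} = {x', y'} \<and> d = graph_dist G (f x') (f y')) = graph_dist G (f x) (f y)"
  by (rule the_equality) (auto simp: doubleton_eq_iff graph_dist_commute)

lemma pseudo_sum_cong:
  assumes "wf_digraph H" and "\<And>v. v \<in> verts H \<Longrightarrow> f v = g v"
  shows "pseudo_sum G H f = pseudo_sum G H g"
  unfolding pseudo_sum_def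
proof (rule sum.cong[OF refl])
  fix e assume "e \<in> edges H"
  then have "e \<subseteq> verts H"
    using wf_digraph.adj_in_verts[OF assms(1)] by (auto simp: edges_def)
  then have "(e = {x, y} \<and> d = graph_dist G (f x) (f y)) \<longleftrightarrow>
      (e = {x, y} \<and> d = graph_dist G (g x) (g y))" for x y d
    using assms(2) by auto
  then show "(THE d. \<exists>x y. e = {x, y} \<and> d = graph_dist G (f x) (f y)) =
      (THE d. \<exists>x y. e = {x, y} \<and> d = graph_dist G (g x) (g y))" by simp
qed

lemma pseudo_sums_finite_nonempty:
  assumes "fin_digraph G" "fin_digraph H" "card (verts G) = card (verts H)"
  shows "finite {pseudo_sum G H f | f. pseudoordering G H f}" (is "finite ?S")
    and "{pseudo_sum G H f | f. pseudoordering G H f} \<noteq> {}"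
proof -
  interpret G: fin_digraph G by fact
  interpret H: fin_digraph H by fact
  have "?S \<subseteq> pseudo_sum G H ` (verts H \<rightarrow>\<^sub>E verts G)"
  proof safe
    fix f assume f: "pseudoordering G H f"
    have "pseudo_sum G H f = pseudo_sum G H (restrict f (verts H))"
      by (rule pseudo_sum_cong) (auto intro: H.wf_digraph)
    moreover have "restrict f (verts H) \<in> verts H \<rightarrow>\<^sub>E verts G"
      using f by (auto simp: pseudoordering_def bij_betw_def)
    ultimately show "pseudo_sum G H f \<in> pseudo_sum G H ` (verts H \<rightarrow>\<^sub>E verts G)" by blast
  qed
  then show "finite ?S"
    by (rule finite_subset) (auto intro!: finite_imageI finite_PiE)
  show "?S \<noteq> {}"
    using finite_same_card_bij[of "verts H" "verts G"] assms(3)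
    by (auto simp: pseudoordering_def)
qed

end

theory Submission
  imports Defs
begin

text \<open>
  In a connected graph \<open>G\<close> two different vertices have distance at least one, with equality
  exactly for adjacent vertices (\<open>graph_dist_pos\<close>, \<open>graph_dist_eq_1_iff\<close>). Under a pseudoordering
  \<open>f\<close> each edge of \<open>H\<close> therefore costs at least one, so that the sum of \<open>f\<close> is at least \<open>|E(H)|\<close>,
  and it is \<open>|E(H)|\<close> precisely when \<open>f\<close> sends edges of \<open>H\<close> to edges of \<open>G\<close>
  (\<open>card_edges_le_pseudo_sum\<close>, \<open>pseudo_sum_eq_card_edges_iff\<close>). Hence \<open>h\<^sub>H(G) = |E(H)|\<close> says that
  there is a bijective homomorphism from \<open>H\<close> to \<open>G\<close>. Such a map is injective on edges, and as \<open>H\<close>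
  and \<open>G\<close> have equally many edges it hits every edge of \<open>G\<close>; so it also reflects adjacency and is
  an isomorphism (\<open>bij_hom_reflects_adjacency\<close>). An isomorphism is trivially a bijective
  homomorphism. Without parallel arcs, a digraph isomorphism is the same as such a vertex
  bijection (\<open>digraph_iso_iff_adjacency\<close>), because the action on arcs is forced.
\<close>

section \<open>Distances zero and one\<close>

context wf_digraph
begin

lemma graph_dist_attained:
  assumes "x \<rightarrow>\<^sup>*\<^bsub>G\<^esub> y"
  obtains p where "awalk x p y" "length p = graph_dist G x y"
proof -
  from assms obtain q where "awalk x q y"
    by (auto simp: reachable_awalk)
  then have "\<exists>n p. awalk x p y \<and> length p = n" by blast
  then have "\<exists>p. awalk x p y \<and> length p = graph_dist G x y"
    unfolding graph_dist_def by (rule LeastI_ex[of "\<lambda>n. \<exists>p. awalk x p y \<and> length p = n"])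
  then show thesis using that by blast
qed

lemma graph_dist_le: "awalk x p y \<Longrightarrow> graph_dist G x y \<le> length p"
  unfolding graph_dist_def by (rule Least_le) blast

lemma graph_dist_pos:
  assumes "x \<rightarrow>\<^sup>*\<^bsub>G\<^esub> y" "x \<noteq> y"
  shows "1 \<le> graph_dist G x y"
proof -
  from assms(1) obtain p where "awalk x p y" "length p = graph_dist G x y"
    by (rule graph_dist_attained)
  with assms(2) show ?thesis
    by (cases p) (auto simp: awalk_Nil_iff)
qed

lemma graph_dist_eq_1_iff:
  assumes "x \<rightarrow>\<^sup>*\<^bsub>G\<^esub> y" "x \<noteq> y"
  shows "graph_dist G x y = 1 \<longleftrightarrow> x \<rightarrow>\<^bsub>G\<^esub> y"
proof
  assume 1: "graph_dist G x y = 1"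
  from assms(1) obtain p where "awalk x p y" "length p = graph_dist G x y"
    by (rule graph_dist_attained)
  with 1 obtain e where "awalk x [e] y"
    by (auto simp: length_Suc_conv)
  then show "x \<rightarrow>\<^bsub>G\<^esub> y"
    by (auto simp: awalk_Cons_iff awalk_Nil_iff arcs_ends_conv)
next
  assume "x \<rightarrow>\<^bsub>G\<^esub> y"
  then obtain e where "e \<in> arcs G" "tail G e = x" "head G e = y"
    by (auto simp: arcs_ends_conv)
  then have "awalk x [e] y"
    by (auto simp: awalk_Cons_iff awalk_Nil_iff)
  then have "graph_dist G x y \<le> 1"
    by (auto dest: graph_dist_le)
  with graph_dist_pos[OF assms] show "graph_dist G x y = 1" by simp
qed

end

section \<open>Edges as unordered pairs\<close>

lemma (in wf_digraph) edges_subset_Pow: "edges G \<subseteq> Pow (verts G)"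
  by (auto simp: edges_def dest: adj_in_verts)

lemma (in fin_digraph) finite_edges: "finite (edges G)"
  by (rule finite_subset[OF edges_subset_Pow]) simp

lemma (in sym_digraph) doubleton_in_edges_iff: "{x, y} \<in> edges G \<longleftrightarrow> x \<rightarrow>\<^bsub>G\<^esub> y"
proof -
  have "{x, y} \<in> edges G \<longleftrightarrow> x \<rightarrow>\<^bsub>G\<^esub> y \<or> y \<rightarrow>\<^bsub>G\<^esub> x"
    unfolding edges_def mem_Collect_eq doubleton_eq_iff by blast
  then show ?thesis
    using arcs_ends_symmetric[OF sym_arcs] by blast
qed

section \<open>Pseudoorderings of minimal sum\<close>

locale graph_pseudoordering =
  G: graph G + H: graph H
  for G :: "('a, 'b) pre_digraph" and H :: "('c, 'd) pre_digraph" +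
  fixes f :: "'c \<Rightarrow> 'a"
  assumes connected: "Digraph_Component.connected G"
    and pseudoordering: "pseudoordering G H f"
begin

abbreviation cost :: "'c set \<Rightarrow> nat" where
  "cost e \<equiv> THE d. \<exists>x y. e = {x, y} \<and> d = graph_dist G (f x) (f y)"

lemma inj_on_verts: "inj_on f (verts H)" and image_verts: "f ` verts H = verts G"
  using pseudoordering by (auto simp: pseudoordering_def bij_betw_def)

lemma endpoints_of_edge:
  assumes "x \<rightarrow>\<^bsub>H\<^esub> y"
  shows "f x \<rightarrow>\<^sup>*\<^bsub>G\<^esub> f y" "f x \<noteq> f y"
proof -
  have xy: "x \<in> verts H" "y \<in> verts H"
    using H.adj_in_verts assms by auto
  have "strongly_connected G"
    using G.symmetric_connected_imp_strongly_connected G.sym_arcs connected by blast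
  then show "f x \<rightarrow>\<^sup>*\<^bsub>G\<^esub> f y"
    using xy image_verts by (auto simp: strongly_connected_def)
  have "x \<noteq> y"
    using assms H.no_loops by (auto simp: arcs_ends_conv)
  then show "f x \<noteq> f y"
    using xy inj_on_verts by (auto dest: inj_onD)
qed

lemma cost_pos:
  assumes "e \<in> edges H" shows "1 \<le> cost e"
  using assms endpoints_of_edge G.graph_dist_pos by (auto simp: edges_def G.edge_summand)

text \<open>The excess of the sum over \<open>|E(H)|\<close> is itself a sum of nonnegative terms; both the lower
  bound and its equality case are read off from it.\<close>

lemma pseudo_sum_eq_card_edges_plus_excess:
  "pseudo_sum G H f = card (edges H) + (\<Sum>e\<in>edges H. cost e - 1)"
proof -
  have "pseudo_sum G H f = (\<Sum>e\<in>edges H. 1 + (cost e - 1))"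
    unfolding pseudo_sum_def by (intro sum.cong le_add_diff_inverse[symmetric] cost_pos refl)
  then show ?thesis by (simp only: sum.distrib) simp
qed

lemma card_edges_le_pseudo_sum: "card (edges H) \<le> pseudo_sum G H f"
  by (simp add: pseudo_sum_eq_card_edges_plus_excess)

lemma pseudo_sum_eq_card_edges_iff:
  "pseudo_sum G H f = card (edges H) \<longleftrightarrow> (\<forall>x y. x \<rightarrow>\<^bsub>H\<^esub> y \<longrightarrow> f x \<rightarrow>\<^bsub>G\<^esub> f y)"
proof -
  have "pseudo_sum G H f = card (edges H) \<longleftrightarrow> (\<forall>e\<in>edges H. cost e - 1 = 0)"
    by (simp add: pseudo_sum_eq_card_edges_plus_excess H.finite_edges)
  also have "\<dots> \<longleftrightarrow> (\<forall>e\<in>edges H. cost e = 1)"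
    using cost_pos by (intro ball_cong) (auto simp: le_antisym)
  also have "\<dots> \<longleftrightarrow> (\<forall>x y. x \<rightarrow>\<^bsub>H\<^esub> y \<longrightarrow> graph_dist G (f x) (f y) = 1)"
    by (auto simp: edges_def G.edge_summand) (metis G.edge_summand)
  also have "\<dots> \<longleftrightarrow> (\<forall>x y. x \<rightarrow>\<^bsub>H\<^esub> y \<longrightarrow> f x \<rightarrow>\<^bsub>G\<^esub> f y)"
    using endpoints_of_edge G.graph_dist_eq_1_iff by blast
  finally show ?thesis .
qed

end

section \<open>Bijective homomorphisms and isomorphisms\<close>

text \<open>On vertex sets the map \<open>e \<mapsto> f(e)\<close> is injective, so a bijective homomorphism between graphs with
  equally many edges is a bijection between the (finite) edge sets.\<close>

lemma bij_hom_reflects_adjacency: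
  assumes "pseudo_graph G" "sym_digraph H"
    and inj: "inj_on f (verts H)"
    and hom: "\<And>x y. x \<rightarrow>\<^bsub>H\<^esub> y \<Longrightarrow> f x \<rightarrow>\<^bsub>G\<^esub> f y"
    and card: "card (edges G) = card (edges H)"
    and xy: "x \<in> verts H" "y \<in> verts H" "f x \<rightarrow>\<^bsub>G\<^esub> f y"
  shows "x \<rightarrow>\<^bsub>H\<^esub> y"
proof -
  interpret G: pseudo_graph G by fact
  interpret H: sym_digraph H by fact
  have inj_image: "inj_on ((`) f) (Pow (verts H))"
    using inj by (rule inj_on_image_Pow)
  have "(`) f ` edges H \<subseteq> edges G"
    using hom by (auto simp: edges_def)
  moreover have "card ((`) f ` edges H) = card (edges G)"
    using card card_image[OF inj_on_subset[OF inj_image H.edges_subset_Pow]] by simp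
  ultimately have "(`) f ` edges H = edges G"
    using G.finite_edges by (intro card_subset_eq)
  moreover have "f ` {x, y} \<in> edges G"
    using xy(3) by (simp add: G.doubleton_in_edges_iff)
  ultimately obtain e where "e \<in> edges H" "f ` e = f ` {x, y}"
    by (metis imageE)
  then have "{x, y} \<in> edges H"
    using inj_onD[OF inj_image, of e "{x, y}"] H.edges_subset_Pow xy(1,2) by auto
  then show ?thesis by (simp add: H.doubleton_in_edges_iff)
qed

text \<open>Without parallel arcs an arc is determined by its end points. A vertex bijection that respects
  adjacency in both directions therefore extends to exactly one map on arcs, which is bijective.\<close>

lemma digraph_iso_iff_adjacency:
  assumes "nomulti_digraph H" "nomulti_digraph G"
  shows "digraph_iso H G \<longleftrightarrow>
    (\<exists>f. bij_betw f (verts H) (verts G) \<and>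
      (\<forall>x\<in>verts H. \<forall>y\<in>verts H. x \<rightarrow>\<^bsub>H\<^esub> y \<longleftrightarrow> f x \<rightarrow>\<^bsub>G\<^esub> f y))"
proof
  interpret H: nomulti_digraph H by fact
  assume "digraph_iso H G"
  then obtain h where h: "H.digraph_isomorphism h" and G: "G = app_iso h H"
    by (auto simp: digraph_iso_def)
  let ?f = "iso_verts h"
  have inj: "inj_on ?f (verts H)"
    using h by (rule H.digraph_isomorphism_inj_on_verts)
  have "x \<rightarrow>\<^bsub>H\<^esub> y \<longleftrightarrow> ?f x \<rightarrow>\<^bsub>G\<^esub> ?f y" if "x \<in> verts H" "y \<in> verts H" for x y
  proof
    assume "x \<rightarrow>\<^bsub>H\<^esub> y"
    then show "?f x \<rightarrow>\<^bsub>G\<^esub> ?f y"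
      unfolding G H.arcs_ends_app_iso_eq[OF h] by (rule rev_image_eqI) simp
  next
    assume "?f x \<rightarrow>\<^bsub>G\<^esub> ?f y"
    then obtain u v where uv: "u \<rightarrow>\<^bsub>H\<^esub> v" "?f x = ?f u" "?f y = ?f v"
      unfolding G H.arcs_ends_app_iso_eq[OF h] by auto
    then have "x = u" "y = v"
      using that H.adj_in_verts[OF uv(1)] inj_onD[OF inj] by auto
    with uv(1) show "x \<rightarrow>\<^bsub>H\<^esub> y" by simp
  qed
  moreover have "bij_betw ?f (verts H) (verts G)"
    using inj by (simp add: bij_betw_def G)
  ultimately show "\<exists>f. bij_betw f (verts H) (verts G) \<and>
      (\<forall>x\<in>verts H. \<forall>y\<in>verts H. x \<rightarrow>\<^bsub>H\<^esub> y \<longleftrightarrow> f x \<rightarrow>\<^bsub>G\<^esub> f y)" by blast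
next
  interpret H: nomulti_digraph H by fact
  interpret G: nomulti_digraph G by fact
  assume "\<exists>f. bij_betw f (verts H) (verts G) \<and>
      (\<forall>x\<in>verts H. \<forall>y\<in>verts H. x \<rightarrow>\<^bsub>H\<^esub> y \<longleftrightarrow> f x \<rightarrow>\<^bsub>G\<^esub> f y)"
  then obtain f where f: "inj_on f (verts H)" "f ` verts H = verts G"
    and adj: "\<And>x y. x \<in> verts H \<Longrightarrow> y \<in> verts H \<Longrightarrow> x \<rightarrow>\<^bsub>H\<^esub> y \<longleftrightarrow> f x \<rightarrow>\<^bsub>G\<^esub> f y"
    by (auto simp: bij_betw_def)
  have "\<forall>a\<in>arcs H. \<exists>b\<in>arcs G. tail G b = f (tail H a) \<and> head G b = f (head H a)"
  proof
    fix a assume a: "a \<in> arcs H"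
    then have "f (tail H a) \<rightarrow>\<^bsub>G\<^esub> f (head H a)"
      by (subst adj[symmetric]) (auto simp: arcs_ends_conv)
    then show "\<exists>b\<in>arcs G. tail G b = f (tail H a) \<and> head G b = f (head H a)"
      by (auto simp: arcs_ends_conv)
  qed
  then obtain g where g: "\<And>a. a \<in> arcs H \<Longrightarrow>
      g a \<in> arcs G \<and> tail G (g a) = f (tail H a) \<and> head G (g a) = f (head H a)"
    by metis
  have "inj_on g (arcs H)"
  proof (rule inj_onI)
    fix a b assume ab: "a \<in> arcs H" "b \<in> arcs H" "g a = g b"
    then have "f (tail H a) = f (tail H b)" "f (head H a) = f (head H b)"
      using g by metis+
    then show "a = b"
      using ab f(1) by (intro H.no_multi_arcs) (auto simp: arc_to_ends_def dest: inj_onD)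
  qed
  moreover have "g ` arcs H = arcs G"
  proof (intro equalityI subsetI)
    fix b assume b: "b \<in> arcs G"
    then obtain x y where xy: "x \<in> verts H" "y \<in> verts H" "tail G b = f x" "head G b = f y"
      using f(2) G.wellformed by (metis imageE)
    have "f x \<rightarrow>\<^bsub>G\<^esub> f y"
      using b xy(3,4) by (force simp: arcs_ends_conv)
    then have "x \<rightarrow>\<^bsub>H\<^esub> y"
      using adj xy(1,2) by blast
    then obtain a where a: "a \<in> arcs H" "tail H a = x" "head H a = y"
      by (auto simp: arcs_ends_conv)
    then have "g a = b"
      using b g[OF a(1)] xy(3,4) by (intro G.no_multi_arcs) (auto simp: arc_to_ends_def)
    with a(1) show "b \<in> g ` arcs H" by blast
  qed (use g in blast)
  moreover define h where
    "h = \<lparr>iso_verts = f, iso_arcs = g, iso_head = head G, iso_tail = tail G\<rparr>"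
  ultimately have "H.digraph_isomorphism h" "G = app_iso h H"
    using f g H.wf_digraph by (auto simp: H.digraph_isomorphism_def app_iso_def)
  then show "digraph_iso H G"
    by (auto simp: digraph_iso_def)
qed

theorem lemma1p5:
  fixes G :: "('a, 'b) pre_digraph" and H :: "('c, 'd) pre_digraph"
  assumes "graph G" and "Digraph_Component.connected G" and "graph H"
    and "card (verts G) = card (verts H)"
    and "card (edges G) = card (edges H)"
  shows "lower_hamiltonian_number G H = card (edges H) \<longleftrightarrow> digraph_iso H G"
proof -
  interpret G: graph G by fact
  interpret H: graph H by fact
  let ?S = "{pseudo_sum G H f | f. pseudoordering G H f}"
  let ?hom = "\<lambda>f. \<forall>x y. x \<rightarrow>\<^bsub>H\<^esub> y \<longrightarrow> f x \<rightarrow>\<^bsub>G\<^esub> f y"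
  have loc: "graph_pseudoordering G H f" if "pseudoordering G H f" for f
    using that assms by (intro graph_pseudoordering.intro graph_pseudoordering_axioms.intro)
  note S = pseudo_sums_finite_nonempty[OF G.fin_digraph H.fin_digraph assms(4)]
  have "lower_hamiltonian_number G H = card (edges H) \<longleftrightarrow> card (edges H) \<in> ?S"
    unfolding lower_hamiltonian_number_def Min_eq_iff[OF S]
    using loc graph_pseudoordering.card_edges_le_pseudo_sum by blast
  also have "\<dots> \<longleftrightarrow> (\<exists>f. pseudoordering G H f \<and> pseudo_sum G H f = card (edges H))"
    unfolding mem_Collect_eq by metis
  also have "\<dots> \<longleftrightarrow> (\<exists>f. pseudoordering G H f \<and> ?hom f)"
    using loc graph_pseudoordering.pseudo_sum_eq_card_edges_iff by blast
  also have "\<dots> \<longleftrightarrow> (\<exists>f. bij_betw f (verts H) (verts G) \<and>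
      (\<forall>x\<in>verts H. \<forall>y\<in>verts H. x \<rightarrow>\<^bsub>H\<^esub> y \<longleftrightarrow> f x \<rightarrow>\<^bsub>G\<^esub> f y))"
  proof (intro ex_cong1 conj_cong)
    fix f assume "bij_betw f (verts H) (verts G)"
    then have "inj_on f (verts H)" by (rule bij_betw_imp_inj_on)
    with assms(5) show "?hom f \<longleftrightarrow>
        (\<forall>x\<in>verts H. \<forall>y\<in>verts H. x \<rightarrow>\<^bsub>H\<^esub> y \<longleftrightarrow> f x \<rightarrow>\<^bsub>G\<^esub> f y)"
      using bij_hom_reflects_adjacency[OF G.pseudo_graph_axioms H.sym_digraph_axioms, of f]
        H.adj_in_verts by blast
  qed (simp add: pseudoordering_def)
  also have "\<dots> \<longleftrightarrow> digraph_iso H G"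
    by (rule digraph_iso_iff_adjacency[symmetric]) (rule H.nomulti_digraph G.nomulti_digraph)+
  finally show ?thesis .
qed

end
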